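(* Let $f(x), g(x) \in \mathbf{F}_q[x]$ be monic polynomials with $f(0) \neq 0$ and $g(0) \neq 0$. Then the $a$-reciprocal of the product $f(x)g(x)$ is the product of the $a$-reciprocals of $f(x)$ and $g(x)$: $$\widehat{(fg)}_a(x) = \hat{f}_a(x)\cdot \hat{g}_a(x).$$
   Context: Let $q=p^e$ be an odd prime power, $\mathbf{F}_q$ the finite field with $q$ elements, and $a \in \mathbf{F}_q$ with $a \neq 0$. For a monic polynomial $f(x)=\sum_{i=0}^n b_i x^i \in \mathbf{F}_q[x]$ of degree $n$ with $f(0)\neq 0$, the $a$-reciprocal of $f$ is $\hat{f}_a(x) := \frac{x^n}{f(0)} f\left(\frac{a}{x}\right) = \frac{1}{b_0}\sum_{i=0}^n b_i a^i x^{n-i}$, which is again a monic polynomial. *)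

theory Defs
  imports "HOL-Computational_Algebra.Computational_Algebra" "HOL-Library.Cardinality"
begin

text \<open>
  The expanded form \<open>1/b\<^sub>0 * (\<Sum>i\<le>n. b\<^sub>i a\<^sup>i x\<^sup>n\<^sup>-\<^sup>i)\<close> is the definition, since
  \<open>f(a/x)\<close> is not a polynomial; \<open>to_fract_a_reciprocal\<close> below derives the form
  \<open>x\<^sup>n/f(0) * f(a/x)\<close> in the field of rational functions. The function is total, but
  only meaningful for polynomials with nonzero constant term.
\<close>

definition a_reciprocal :: "'a::field \<Rightarrow> 'a poly \<Rightarrow> 'a poly" where
  "a_reciprocal a f =
     smult (1 / poly f 0) (\<Sum>i\<le>degree f. monom (coeff f i * a ^ i) (degree f - i))"

lemma to_fract_sum: "to_fract (sum h A) = (\<Sum>i\<in>A. to_fract (h i))"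
  by (induction A rule: infinite_finite_induct) auto

lemma to_fract_power: "to_fract (x ^ n) = to_fract x ^ n"
  by (induction n) auto

lemma to_fract_a_reciprocal:
  fixes f :: "'a::field poly"
  assumes "poly f 0 \<noteq> 0"
  defines "C \<equiv> (\<lambda>c::'a. to_fract [:c:])" and "X \<equiv> to_fract [:0, 1:]"
  shows "to_fract (a_reciprocal a f) = X ^ degree f / C (poly f 0) * poly (map_poly C f) (C a / X)"
proof -
  have X0: "X \<noteq> 0" by (simp add: X_def)
  have C0: "C c = 0 \<longleftrightarrow> c = 0" for c by (simp add: C_def)
  have Cmult: "C (c * d) = C c * C d" for c d
    unfolding C_def to_fract_mult[symmetric] by simp
  have C1: "C 1 = 1" by (simp add: C_def flip: one_pCons)
  have Cinv: "C (1 / c) = 1 / C c" if "c \<noteq> 0" for c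
    using Cmult[of "1 / c" c] that C0[of c] C1 by (simp add: field_simps)
  have Cpow: "C (c ^ n) = C c ^ n" for c n
    by (induction n) (simp_all add: C1 Cmult)
  have tm: "to_fract (monom c n) = C c * X ^ n" for c n
  proof -
    have "monom c n = [:c:] * [:0, 1:] ^ n"
      by (simp add: monom_altdef)
    thus ?thesis by (simp only: to_fract_mult to_fract_power C_def X_def)
  qed
  have deg: "degree (map_poly C f) = degree f"
    by (rule degree_map_poly) (simp add: C0)
  have co: "coeff (map_poly C f) i = C (coeff f i)" for i
    by (rule coeff_map_poly) (simp add: C0)
  have sm: "to_fract (smult c p) = C c * to_fract p" for c p
    unfolding C_def to_fract_mult[symmetric] by simp
  have "(\<Sum>i\<le>degree f. C (coeff f i * a ^ i) * X ^ (degree f - i)) =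
        X ^ degree f * (\<Sum>i\<le>degree f. C (coeff f i) * (C a / X) ^ i)"
    unfolding sum_distrib_left
    by (intro sum.cong refl)
      (simp add: Cmult Cpow power_divide power_diff X0)
  thus ?thesis using assms(1)
    by (simp add: a_reciprocal_def sm to_fract_sum tm Cinv poly_altdef deg co)
qed

lemma
  fixes f :: "'a::field poly"
  assumes "lead_coeff f = 1" and "poly f 0 \<noteq> 0"
  shows degree_a_reciprocal: "degree (a_reciprocal a f) = degree f"
    and lead_coeff_a_reciprocal: "lead_coeff (a_reciprocal a f) = 1"
proof -
  let ?S = "\<Sum>i\<le>degree f. monom (coeff f i * a ^ i) (degree f - i)"
  have le: "degree ?S \<le> degree f"
    by (intro degree_sum_le) (auto intro: order.trans[OF degree_monom_le])
  have "coeff ?S (degree f) = (\<Sum>i\<le>degree f. if i = 0 then coeff f i * a ^ i else 0)"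
    unfolding coeff_sum by (intro sum.cong refl) auto
  also have "\<dots> = poly f 0"
    by (simp add: poly_0_coeff_0)
  finally have c: "coeff ?S (degree f) = poly f 0" .
  have "coeff (a_reciprocal a f) (degree f) = 1"
    using assms(2) c by (simp add: a_reciprocal_def)
  moreover have "degree (a_reciprocal a f) \<le> degree f"
    using le by (simp add: a_reciprocal_def)
  ultimately show "degree (a_reciprocal a f) = degree f"
    by (metis le_antisym le_degree zero_neq_one)
  with \<open>coeff (a_reciprocal a f) (degree f) = 1\<close>
  show "lead_coeff (a_reciprocal a f) = 1" by simp
qed

end

theory Submission
  imports Defs
begin

text \<open>Up to the factor \<open>1 / f(0)\<close>, the transform is \<open>x^n h(1/x)\<close>
  with \<open>h(x) = f(a x)\<close>, by \<open>a_reciprocal_eq_reflect_poly\<close>. Reversal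
  respects products because degrees add over a field, and evaluation at 0 and substitution are ring
  homomorphisms.\<close>

text \<open>Replacing \<open>x\<close> by \<open>a x\<close> and reversing the coefficients are both multiplicative, and so is
  \<open>f \<mapsto> f(0)\<close>.\<close>

lemma a_reciprocal_eq_reflect_poly:
  fixes a :: "'a::field"
  assumes "a \<noteq> 0"
  shows "a_reciprocal a f = smult (1 / poly f 0) (reflect_poly (f \<circ>\<^sub>p [:0, a:]))"
proof -
  \<comment> \<open>Reversal is relative to the degree, so the substitution must preserve it; this
    is where \<open>a\<close> being nonzero enters.\<close>
  have deg: "degree (f \<circ>\<^sub>p [:0, a:]) = degree f"
    using assms by (simp add: degree_pcompose)
  have "(\<Sum>i\<le>degree f. monom (coeff f i * a ^ i) (degree f - i)) = reflect_poly (f \<circ>\<^sub>p [:0, a:])"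
    (is "?S = _")
  proof (rule poly_eqI)
    fix n
    have "coeff ?S n = (\<Sum>i\<le>degree f. if degree f - i = n then coeff f i * a ^ i else 0)"
      by (simp add: coeff_sum)
    \<comment> \<open>Solving for \<open>i\<close> leaves at most one term. Subtraction truncates:
      for \<open>n > degree f\<close> the index \<open>degree f - n\<close> is 0, and the inner test
      discards that false match.\<close>
    also have "\<dots> = (\<Sum>i\<le>degree f. if i = degree f - n then
        (if n \<le> degree f then coeff f i * a ^ i else 0) else 0)"
      by (intro sum.cong refl) auto
    also have "\<dots> = coeff (reflect_poly (f \<circ>\<^sub>p [:0, a:])) n"
      by (simp add: coeff_reflect_poly deg coeff_pcompose_linear mult.commute)
    finally show "coeff ?S n = coeff (reflect_poly (f \<circ>\<^sub>p [:0, a:])) n" .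
  qed
  thus ?thesis by (simp add: a_reciprocal_def)
qed

text \<open>The scalar \<open>1 / (f(0) g(0))\<close> splits into the two scalars even if a factor
  vanishes, since \<open>1 / 0 = 0\<close>.\<close>

lemma a_reciprocal_mult:
  fixes a :: "'a::field"
  assumes "a \<noteq> 0"
  shows "a_reciprocal a (f * g) = a_reciprocal a f * a_reciprocal a g"
  using assms by (simp add: a_reciprocal_eq_reflect_poly pcompose_mult reflect_poly_mult mult.commute)

theorem theorem1:
  fixes a :: "'a::finite_field" and f g :: "'a poly" and p e q :: nat
  assumes "prime p" and "e \<ge> 1" and "q = p ^ e" and "odd q" and "CARD('a) = q"
    and "a \<noteq> 0"
    and "lead_coeff f = 1" and "poly f 0 \<noteq> 0"
    and "lead_coeff g = 1" and "poly g 0 \<noteq> 0"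
  shows "a_reciprocal a (f * g) = a_reciprocal a f * a_reciprocal a g"
  using \<open>a \<noteq> 0\<close> by (rule a_reciprocal_mult)

end
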